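(* Let $X$ be a first countable topological space, and $G$ be a graph on $X$. The following are equivalent: (1) $\Delta(X)\cap\overline{\bigcup_{p\in\omega}\overline{G}^{\,2p+1}}$ is not empty (closures taken in $X^2$); (2) $(\mathcal{N},\mathbb{G}_m)\preceq_c(X,G)$. Moreover, these conditions imply that $G$ has no continuous 2-coloring.
   Context: A digraph on $X$ is a binary relation on $X$ disjoint from the diagonal $\Delta(X)=\{(x,x)\mid x\in X\}$; a graph is a symmetric digraph. A continuous 2-coloring of $G$ is a continuous map $c:X\to\{0,1\}$ (discrete) with $c(x)\neq c(y)$ whenever $(x,y)\in G$. For a relation $R$ on $X$ and $l\in\omega$, $R^l$ is the set of $(x,y)\in X^2$ for which there are $x_0,\dots,x_l\in X$ with $x_0=x$, $x_l=y$ and $(x_i,x_{i+1})\in R$ for all $i<l$; thus $\overline{G}^{\,2p+1}$ denotes $(\overline{G})^{2p+1}$. $R^{-1}=\{(x,y)\mid(y,x)\in R\}$ and $s(R)=R\cup R^{-1}$. $(X,R)\preceq_c(Y,S)$ means that there is a continuous $\varphi:X\to Y$ with $R\subseteq(\varphi\times\varphi)^{-1}(S)$. $\mathcal{N}=(\{c,a,\overline{a}\}\cup\omega)^\omega$ where $c,a,\overline a$ are three distinct letters not in $\omega$ and $\{c,a,\overline a\}\cup\omega$ is discrete (so $\mathcal N$ is a copy of the Baire space). Elements are written by concatenation: e.g. $c^{k+1}a^{j+1}\overline{a}^\infty$ is $k+1$ letters $c$, then $j+1$ letters $a$, then $\overline{a}$ forever, and $ki^{j+1}a^\infty$ is the letter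 $k\in\omega$, followed by $j+1$ letters $i\in\omega$, followed by $a$ forever. Put $$\mathbb{O}_m=\{(c^{k+1}a^{j+1}\overline{a}^\infty,\,k0^{j+1}\overline{a}^\infty)\mid j,k\in\omega\}\cup\{(ki^{j+1}a^\infty,\,k(i+1)^{j+1}\overline{a}^\infty)\mid j,k\in\omega,\ i\leq 2k\}\cup\{(k(2k+1)^{j+1}a^\infty,\,c^{k+1}\overline{a}^{j+1}a^\infty)\mid j,k\in\omega\}$$ and $\mathbb{G}_m=s(\mathbb{O}_m)$. *)

theory Defs
  imports "HOL-Analysis.Analysis" "HOL-Library.Omega_Words_Fun"
begin

definition digraph_on :: "'a set \<Rightarrow> ('a \<times> 'a) set \<Rightarrow> bool" where
  "digraph_on V G \<longleftrightarrow> G \<subseteq> V \<times> V \<and> G \<inter> Id_on V = {}"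

definition graph_on :: "'a set \<Rightarrow> ('a \<times> 'a) set \<Rightarrow> bool" where
  "graph_on V G \<longleftrightarrow> digraph_on V G \<and> sym G"

definition continuous_2_coloring ::
    "'a topology \<Rightarrow> ('a \<times> 'a) set \<Rightarrow> ('a \<Rightarrow> nat) \<Rightarrow> bool" where
  "continuous_2_coloring X G c \<longleftrightarrow>
     continuous_map X (discrete_topology {0, 1}) c \<and> (\<forall>(x, y) \<in> G. c x \<noteq> c y)"

definition symmetrization :: "('a \<times> 'a) set \<Rightarrow> ('a \<times> 'a) set" where
  "symmetrization R = R \<union> R\<inverse>"

definition cont_reducible ::
    "'a topology \<Rightarrow> ('a \<times> 'a) set \<Rightarrow> 'b topology \<Rightarrow> ('b \<times> 'b) set \<Rightarrow> bool" where
  "cont_reducible X R Y S \<longleftrightarrow> (\<exists>\<phi>. continuous_map X Y \<phi> \<and> R \<subseteq> map_prod \<phi> \<phi> -` S)"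

text \<open>\<open>Abar\<close> is the overlined letter \<open>a\<close>; \<open>Num k\<close> is the natural number \<open>k\<close> as a letter.\<close>

datatype letter = C | A | Abar | Num nat

definition N_space :: "letter word topology" where
  "N_space = product_topology (\<lambda>_. discrete_topology UNIV) UNIV"

text \<open>The words \<open>u \<frown> (\<lambda>_. l)\<close> below are the finite word \<open>u\<close> followed by the letter \<open>l\<close> forever.\<close>

definition O_m :: "(letter word \<times> letter word) set" where
  "O_m =
     {((replicate (k + 1) C @ replicate (j + 1) A) \<frown> (\<lambda>_. Abar),
       (Num k # replicate (j + 1) (Num 0)) \<frown> (\<lambda>_. Abar)) | j k. True} \<union>
     {((Num k # replicate (j + 1) (Num i)) \<frown> (\<lambda>_. A),
       (Num k # replicate (j + 1) (Num (i + 1))) \<frown> (\<lambda>_. Abar)) | j k i. i \<le> 2 * k} \<union>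
     {((Num k # replicate (j + 1) (Num (2 * k + 1))) \<frown> (\<lambda>_. A),
       (replicate (k + 1) C @ replicate (j + 1) Abar) \<frown> (\<lambda>_. A)) | j k. True}"

definition G_m :: "(letter word \<times> letter word) set" where
  "G_m = symmetrization O_m"

end

theory Submission
  imports Defs
begin

text \<open>Let the odd hull of a relation be the closure of the union of the odd powers of its closure.
  The theorem says that the graph on words is minimal among the graphs on
  first countable spaces whose odd hull has a loop.

  A continuous homomorphism carries closures and powers along, so it maps loops of the odd hull to
  loops of the odd hull (\<open>odd_hull_continuous_image\<close>).  The odd hull of the graph on words has a
  loop at \<open>C\<^sup>\<infinity>\<close>: for each \<open>k\<close> the limits of the edges with index \<open>k\<close> form a path of length
  \<open>2k + 3\<close>, and both ends of this path tend to \<open>C\<^sup>\<infinity>\<close> (\<open>odd_hull_G_m_loop\<close>).  Hence reducibility gives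
  a loop for \<open>G\<close>.  A continuous 2-coloring is a homomorphism to a single edge between two discrete
  points, which is its own odd hull and has no loop, so a loop for \<open>G\<close> excludes a coloring
  (\<open>odd_hull_loop_imp_no_coloring\<close>).

  Conversely, let \<open>(x, x)\<close> be in the odd hull of \<open>G\<close>.  Because \<open>G\<close> is symmetric, paths can be
  lengthened by two, and a diagonal choice along a countable neighborhood base at \<open>x\<close> gives for
  every \<open>k\<close> a path of length exactly \<open>2k + 3\<close> in the closure of \<open>G\<close>, with ends that tend to \<open>x\<close>
  (\<open>odd_hull_loop_imp_paths\<close>).  Each step of these paths is the limit of a sequence of edges of
  \<open>G\<close>.  This is the shape of the graph on words, and the homomorphism just follows it: \<open>C\<^sup>\<infinity>\<close> goes
  to \<open>x\<close>, the words with one infinite run over index \<open>k\<close> go to the vertices of the \<open>k\<close>-th path, and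
  the words with a finite run of length \<open>n\<close> go to the ends of the \<open>n\<close>-th edge of an approximating
  sequence.  Reading runs makes the map locally constant except at the limit words, where
  continuity is the convergence just arranged (\<open>continuous_map_path_map\<close>).\<close>


section \<open>Closures in a square and the odd hull\<close>

definition odd_hull :: "'a topology \<Rightarrow> ('a \<times> 'a) set \<Rightarrow> ('a \<times> 'a) set" where
  "odd_hull X R = prod_topology X X closure_of
     (\<Union>p::nat. (prod_topology X X closure_of R) ^^ (2 * p + 1))"

lemma closure_of_prod_topologyE:
  assumes "(y, z) \<in> prod_topology X Y closure_of R"
    and "openin X V" "y \<in> V" "openin Y W" "z \<in> W"
  obtains a b where "(a, b) \<in> R" "a \<in> V" "b \<in> W"
proof -
  have "openin (prod_topology X Y) (V \<times> W)" "(y, z) \<in> V \<times> W"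
    using assms by (simp_all add: openin_prod_Times_iff)
  with assms(1) obtain e where "e \<in> R" "e \<in> V \<times> W"
    unfolding in_closure_of by metis
  with that show thesis
    by blast
qed

lemma closure_of_prod_topologyI:
  assumes "y \<in> topspace X" "z \<in> topspace Y"
    and "\<And>V W. \<lbrakk>openin X V; y \<in> V; openin Y W; z \<in> W\<rbrakk> \<Longrightarrow> \<exists>a b. (a, b) \<in> R \<and> a \<in> V \<and> b \<in> W"
  shows "(y, z) \<in> prod_topology X Y closure_of R"
  unfolding in_closure_of
proof (intro conjI allI impI)
  show "(y, z) \<in> topspace (prod_topology X Y)"
    using assms(1,2) by simp
  fix T assume "(y, z) \<in> T \<and> openin (prod_topology X Y) T"
  then obtain V W where VW: "openin X V" "openin Y W" "y \<in> V" "z \<in> W" "V \<times> W \<subseteq> T"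
    unfolding openin_prod_topology_alt by blast
  with assms(3)[of V W] obtain a b where "(a, b) \<in> R" "a \<in> V" "b \<in> W"
    by auto
  with VW(5) show "\<exists>e. e \<in> R \<and> e \<in> T"
    by blast
qed

lemma closure_of_prod_topology_topspace:
  assumes "(y, z) \<in> prod_topology X Y closure_of R"
  shows "y \<in> topspace X" "z \<in> topspace Y"
  using assms[unfolded in_closure_of, THEN conjunct1] by simp_all

lemma sym_closure_of_prod_topology:
  assumes "sym R"
  shows "sym (prod_topology X X closure_of R)"
proof (rule symI)
  fix y z assume yz: "(y, z) \<in> prod_topology X X closure_of R"
  show "(z, y) \<in> prod_topology X X closure_of R"
  proof (rule closure_of_prod_topologyI)
    fix W V assume "openin X W" "z \<in> W" "openin X V" "y \<in> V"
    with yz obtain a b where "(a, b) \<in> R" "a \<in> V" "b \<in> W"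
      by (elim closure_of_prod_topologyE)
    with assms show "\<exists>b a. (b, a) \<in> R \<and> b \<in> W \<and> a \<in> V"
      by (auto dest: symD)
  qed (use yz in \<open>auto dest: closure_of_prod_topology_topspace\<close>)
qed

lemma closure_of_prod_limit:
  assumes "\<And>n. (f n, g n) \<in> R" "limitin X f y sequentially" "limitin X g z sequentially"
  shows "(y, z) \<in> prod_topology X X closure_of R"
proof (rule closure_of_prod_topologyI)
  show "y \<in> topspace X" "z \<in> topspace X"
    using assms(2,3) by (simp_all add: limitin_def)
  fix V W assume VW: "openin X V" "y \<in> V" "openin X W" "z \<in> W"
  have "\<forall>\<^sub>F n in sequentially. f n \<in> V" "\<forall>\<^sub>F n in sequentially. g n \<in> W"
    using assms(2,3) VW unfolding limitin_def by blast+
  then have "\<forall>\<^sub>F n in sequentially. f n \<in> V \<and> g n \<in> W"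
    by (rule eventually_conj)
  then obtain n where "f n \<in> V \<and> g n \<in> W"
    using eventually_happens'[OF sequentially_bot] by blast
  with assms(1) show "\<exists>a b. (a, b) \<in> R \<and> a \<in> V \<and> b \<in> W"
    by blast
qed

lemma closure_of_prod_continuous_image:
  assumes f: "continuous_map X Y f" and hom: "\<And>a b. (a, b) \<in> R \<Longrightarrow> (f a, f b) \<in> S"
    and yz: "(y, z) \<in> prod_topology X X closure_of R"
  shows "(f y, f z) \<in> prod_topology Y Y closure_of S"
proof (rule closure_of_prod_topologyI)
  note top = closure_of_prod_topology_topspace[OF yz]
  then show "f y \<in> topspace Y" "f z \<in> topspace Y"
    using f by (auto simp: continuous_map_def)
  fix V W assume VW: "openin Y V" "f y \<in> V" "openin Y W" "f z \<in> W"
  then have "openin X {a \<in> topspace X. f a \<in> V}" "openin X {a \<in> topspace X. f a \<in> W}"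
    using f by (auto simp: continuous_map_def)
  then obtain a b where "(a, b) \<in> R" "f a \<in> V" "f b \<in> W"
    using closure_of_prod_topologyE[OF yz, of "{a \<in> topspace X. f a \<in> V}" "{a \<in> topspace X. f a \<in> W}"]
      VW top by blast
  with hom show "\<exists>a b. (a, b) \<in> S \<and> a \<in> V \<and> b \<in> W"
    by blast
qed

lemma relpow_image:
  assumes "(x, y) \<in> R ^^ n" "\<And>a b. (a, b) \<in> R \<Longrightarrow> (f a, f b) \<in> S"
  shows "(f x, f y) \<in> S ^^ n"
  using assms(1) by (induction n arbitrary: y) (auto intro: assms(2))

text \<open>Closures and relational powers are both carried along by a continuous homomorphism, hence
  so is the odd hull.  This single fact transports a loop from the words to \<open>X\<close>, and it also
  transports a loop along a continuous 2-coloring, regarded as a homomorphism to an edge.\<close>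

lemma odd_hull_continuous_image:
  assumes "continuous_map X Y f" "R \<subseteq> map_prod f f -` S" "(y, z) \<in> odd_hull X R"
  shows "(f y, f z) \<in> odd_hull Y S"
  using assms(3) unfolding odd_hull_def
proof (rule closure_of_prod_continuous_image[OF assms(1), rotated])
  fix a b
  assume "(a, b) \<in> (\<Union>p::nat. (prod_topology X X closure_of R) ^^ (2 * p + 1))"
  then obtain p where "(a, b) \<in> (prod_topology X X closure_of R) ^^ (2 * p + 1)"
    by blast
  then have "(f a, f b) \<in> (prod_topology Y Y closure_of S) ^^ (2 * p + 1)"
    by (rule relpow_image) (rule closure_of_prod_continuous_image[OF assms(1)],
        use assms(2) in auto)
  then show "(f a, f b) \<in> (\<Union>p::nat. (prod_topology Y Y closure_of S) ^^ (2 * p + 1))"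
    by blast
qed

text \<open>A single edge between two discrete points is closed and equal to its odd powers, so it is
  its own odd hull.  It has no loop, and pulling this back rules out a coloring.\<close>

lemma odd_hull_loop_imp_no_coloring:
  assumes "G \<subseteq> topspace X \<times> topspace X" "(x, x) \<in> odd_hull X G"
  shows "\<not> continuous_2_coloring X G c"
proof
  assume c: "continuous_2_coloring X G c"
  define E where "E = {(0::nat, 1::nat), (1, 0)}"
  let ?D = "discrete_topology {0, 1::nat}"
  have cont: "continuous_map X ?D c"
    using c by (simp add: continuous_2_coloring_def)
  have "(c a, c b) \<in> E" if "(a, b) \<in> G" for a b
  proof -
    have "c a \<in> {0, 1}" "c b \<in> {0, 1}"
      using that assms(1) cont by (auto simp: continuous_map_def)
    moreover have "c a \<noteq> c b"
      using c that by (auto simp: continuous_2_coloring_def)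
    ultimately show ?thesis
      by (auto simp: E_def)
  qed
  then have "G \<subseteq> map_prod c c -` E"
    by auto
  with cont assms(2) have loop: "(c x, c x) \<in> odd_hull ?D E"
    by (blast intro: odd_hull_continuous_image)
  have closed: "prod_topology ?D ?D closure_of E = E"
    unfolding prod_topology_discrete_topology[symmetric] discrete_topology_closure_of
    by (auto simp: E_def)
  have cube: "E O E O E = E"
    by (auto simp: E_def)
  have "E ^^ (2 * p + 1) = E" for p
  proof (induction p)
    case (Suc p)
    have "E ^^ (2 * Suc p + 1) = E ^^ (2 * p + 1) O E O E"
      by (simp add: O_assoc)
    with Suc cube show ?case
      by simp
  qed simp
  then have "odd_hull ?D E = E"
    unfolding odd_hull_def closed by (simp only: closed UN_constant UNIV_not_empty if_False)
  with loop have "(c x, c x) \<in> E"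
    by simp
  then show False
    by (auto simp: E_def)
qed


section \<open>Continuity on the space of words\<close>

lemma openin_N_space:
  "openin N_space S \<longleftrightarrow> (\<forall>w\<in>S. \<exists>n. \<forall>v. (\<forall>i<n. v i = w i) \<longrightarrow> v \<in> S)" (is "_ = ?R")
proof
  assume op: "openin N_space S"
  show ?R
  proof
    fix w assume "w \<in> S"
    then obtain U where U: "finite {i. U i \<noteq> UNIV}" "w \<in> Pi\<^sub>E UNIV U" "Pi\<^sub>E UNIV U \<subseteq> S"
      using op unfolding N_space_def openin_product_topology_alt by auto
    obtain n where n: "\<And>i. U i \<noteq> UNIV \<Longrightarrow> i < n"
      using U(1) unfolding finite_nat_set_iff_bounded by auto
    have "v \<in> S" if "\<forall>i<n. v i = w i" for v
    proof -
      have "v i \<in> U i" for i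
        using n[of i] that U(2) by (cases "U i = UNIV") auto
      then show ?thesis
        using U(3) by auto
    qed
    then show "\<exists>n. \<forall>v. (\<forall>i<n. v i = w i) \<longrightarrow> v \<in> S"
      by blast
  qed
next
  assume R: ?R
  show "openin N_space S"
    unfolding N_space_def openin_product_topology_alt
  proof
    fix w assume "w \<in> S"
    with R obtain n where n: "\<And>v. (\<forall>i<n. v i = w i) \<Longrightarrow> v \<in> S"
      by blast
    define U where "U i = (if i < n then {w i} else UNIV)" for i
    have "{i. U i \<noteq> UNIV} \<subseteq> {..<n}"
      by (auto simp: U_def)
    then have "finite {i. U i \<noteq> UNIV}"
      by (rule finite_subset) simp
    moreover have "w \<in> Pi\<^sub>E UNIV U"
      by (auto simp: U_def)
    moreover have "v \<in> S" if "v \<in> Pi\<^sub>E UNIV U" for v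
    proof (rule n, intro allI impI)
      fix i assume "i < n"
      moreover have "v i \<in> U i"
        using that by auto
      ultimately show "v i = w i"
        by (simp add: U_def)
    qed
    ultimately show "\<exists>U. finite {i \<in> UNIV. U i \<noteq> topspace (discrete_topology UNIV)} \<and>
        (\<forall>i\<in>UNIV. openin (discrete_topology UNIV) (U i)) \<and> w \<in> Pi\<^sub>E UNIV U \<and> Pi\<^sub>E UNIV U \<subseteq> S"
      by (intro exI[of _ U]) auto
  qed
qed

lemma topspace_N_space [simp]: "topspace N_space = UNIV"
  by (simp add: N_space_def)

lemma continuous_map_N_space:
  "continuous_map N_space X f \<longleftrightarrow>
     (\<forall>w. f w \<in> topspace X) \<and>
     (\<forall>w U. openin X U \<and> f w \<in> U \<longrightarrow> (\<exists>n. \<forall>v. (\<forall>i<n. v i = w i) \<longrightarrow> f v \<in> U))"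
  by (simp add: continuous_map_def openin_N_space Pi_iff) blast

lemma limitin_N_space:
  assumes "\<And>i. \<forall>\<^sub>F n in sequentially. f n i = w i"
  shows "limitin N_space f w sequentially"
  unfolding N_space_def limitin_componentwise
proof (intro conjI ballI)
  fix i
  show "limitin (discrete_topology UNIV) (\<lambda>n. f n i) (w i) sequentially"
    using assms[of i] unfolding limitin_def by (auto elim: eventually_mono)
qed auto

lemma limitin_N_space_long_run:
  "limitin N_space (\<lambda>j. (u @ replicate (j + 1) l) \<frown> v) (u \<frown> (\<lambda>_. l)) sequentially"
proof (rule limitin_N_space)
  fix i
  have "((u @ replicate (j + 1) l) \<frown> v) i = (u \<frown> (\<lambda>_. l)) i" if "i \<le> j" for j
    using that by (auto simp: conc_def nth_append simp del: replicate_Suc)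
  then show "\<forall>\<^sub>F j in sequentially. ((u @ replicate (j + 1) l) \<frown> v) i = (u \<frown> (\<lambda>_. l)) i"
    unfolding eventually_sequentially by blast
qed

lemma continuous_map_N_space_first_letter:
  assumes "\<And>l. continuous_map N_space X (f l)"
  shows "continuous_map N_space X (\<lambda>w. f (w 0) w)"
  unfolding continuous_map_N_space
proof (intro conjI allI impI)
  fix w show "f (w 0) w \<in> topspace X"
    using assms by (simp add: continuous_map_N_space)
  fix U assume "openin X U \<and> f (w 0) w \<in> U"
  then obtain n where n: "\<And>v. (\<forall>i<n. v i = w i) \<Longrightarrow> f (w 0) v \<in> U"
    using assms[of "w 0"] unfolding continuous_map_N_space by blast
  have "f (v 0) v \<in> U" if "\<forall>i<Suc n. v i = w i" for v
  proof -
    have "v 0 = w 0"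
      using that by blast
    with n[of v] that show ?thesis
      by simp
  qed
  then show "\<exists>n. \<forall>v. (\<forall>i<n. v i = w i) \<longrightarrow> f (v 0) v \<in> U"
    by blast
qed

lemma continuous_map_N_space_suffix:
  assumes "continuous_map N_space X f"
  shows "continuous_map N_space X (\<lambda>w. f (suffix k w))"
  unfolding continuous_map_N_space
proof (intro conjI allI impI)
  fix w show "f (suffix k w) \<in> topspace X"
    using assms by (simp add: continuous_map_N_space)
  fix U assume "openin X U \<and> f (suffix k w) \<in> U"
  then obtain n where n: "\<And>v. (\<forall>i<n. v i = suffix k w i) \<Longrightarrow> f v \<in> U"
    using assms unfolding continuous_map_N_space by blast
  have "f (suffix k v) \<in> U" if "\<forall>i<k + n. v i = w i" for v
    using that by (intro n) auto
  then show "\<exists>n. \<forall>v. (\<forall>i<n. v i = w i) \<longrightarrow> f (suffix k v) \<in> U"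
    by blast
qed


section \<open>Reading a run of equal letters\<close>

text \<open>The vertices of the graph on words are told apart by successive runs of equal letters, so maps
  out of the space of words are assembled from one building block: read the initial run of the
  letter \<open>l\<close>, then continue according to its length on the rest of the word; the value at the word
  whose run is infinite is \<open>z\<close>.\<close>

definition read_run ::
    "letter \<Rightarrow> 'a \<Rightarrow> (nat \<Rightarrow> letter word \<Rightarrow> 'a) \<Rightarrow> letter word \<Rightarrow> 'a" where
  "read_run l z f w =
     (if w = (\<lambda>_. l) then z else let n = LEAST n. w n \<noteq> l in f n (suffix n w))"

lemma read_run_infinite [simp]: "read_run l z f (\<lambda>_. l) = z"
  by (simp add: read_run_def)

lemma read_run_eq:
  assumes "\<And>i. i < n \<Longrightarrow> w i = l" "w n \<noteq> l"
  shows "read_run l z f w = f n (suffix n w)"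
proof -
  have "(LEAST n. w n \<noteq> l) = n"
    by (rule Least_equality) (use assms in \<open>auto simp: not_le[symmetric]\<close>)
  with assms(2) show ?thesis
    by (auto simp: read_run_def)
qed

lemma read_run_replicate:
  assumes "v 0 \<noteq> l"
  shows "read_run l z f (replicate n l \<frown> v) = f n v"
proof -
  have "read_run l z f (replicate n l \<frown> v) = f n (suffix n (replicate n l \<frown> v))"
    by (rule read_run_eq) (use assms in \<open>auto simp: conc_def\<close>)
  also have "suffix n (replicate n l \<frown> v) = v"
    by (auto simp: fun_eq_iff conc_def)
  finally show ?thesis .
qed

lemma read_run_cases:
  fixes w :: "letter word"
  obtains "w = (\<lambda>_. l)"
  | n where "\<And>i. i < n \<Longrightarrow> w i = l" "w n \<noteq> l"
proof (cases "w = (\<lambda>_. l)")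
  case False
  then have "\<exists>n. w n \<noteq> l"
    by auto
  then have "w (LEAST n. w n \<noteq> l) \<noteq> l"
    by (rule LeastI_ex[of "\<lambda>n. w n \<noteq> l"])
  moreover have "w i = l" if "i < (LEAST n. w n \<noteq> l)" for i
    using not_less_Least[OF that] by blast
  ultimately show ?thesis
    using that by blast
qed (use that in blast)

text \<open>A finite run ends at a letter which already lies in a finite prefix, so near such a word
  only one of the maps \<open>f n\<close> matters.  The one place where infinitely many of them meet is the
  infinite run, and there continuity is the uniform convergence of \<open>f n\<close> to \<open>z\<close>.\<close>

lemma continuous_map_read_run:
  assumes "\<And>n. continuous_map N_space X (f n)" "z \<in> topspace X"
    and lim: "\<And>U. openin X U \<Longrightarrow> z \<in> U \<Longrightarrow> \<forall>\<^sub>F n in sequentially. \<forall>v. f n v \<in> U"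
  shows "continuous_map N_space X (read_run l z f)"
  unfolding continuous_map_N_space
proof (intro conjI allI impI)
  fix w
  show "read_run l z f w \<in> topspace X"
    using assms(1,2) by (auto simp: read_run_def Let_def continuous_map_N_space)
  fix U assume U: "openin X U \<and> read_run l z f w \<in> U"
  show "\<exists>n. \<forall>v. (\<forall>i<n. v i = w i) \<longrightarrow> read_run l z f v \<in> U"
  proof (rule read_run_cases[of w l])
    assume w: "w = (\<lambda>_. l)"
    with U have z: "z \<in> U"
      by simp
    then have "\<forall>\<^sub>F n in sequentially. \<forall>v. f n v \<in> U"
      using lim U by blast
    then obtain N where N: "\<And>n v. n \<ge> N \<Longrightarrow> f n v \<in> U"
      unfolding eventually_sequentially by blast
    have "read_run l z f v \<in> U" if v: "\<forall>i<N. v i = w i" for v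
    proof (rule read_run_cases[of v l])
      fix n assume n: "\<And>i. i < n \<Longrightarrow> v i = l" "v n \<noteq> l"
      then have "N \<le> n"
        using v w by (metis not_le)
      then show ?thesis
        using N read_run_eq[of n v l z f, OF n] by simp
    qed (use z in simp)
    then show ?thesis
      by blast
  next
    fix n assume n: "\<And>i. i < n \<Longrightarrow> w i = l" "w n \<noteq> l"
    have "f n (suffix n w) \<in> U"
      using U read_run_eq[of n w l z f, OF n] by simp
    then obtain m where m: "\<And>v. (\<forall>i<m. v i = suffix n w i) \<Longrightarrow> f n v \<in> U"
      using assms(1)[of n] U unfolding continuous_map_N_space by blast
    have "read_run l z f v \<in> U" if v: "\<forall>i<Suc (n + m). v i = w i" for v
    proof -
      have "read_run l z f v = f n (suffix n v)"
        by (rule read_run_eq) (use v n in auto)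
      also have "\<dots> \<in> U"
        using v by (intro m) auto
      finally show ?thesis .
    qed
    then show ?thesis
      by blast
  qed
qed

lemma continuous_map_read_run_sequence:
  assumes "limitin X s z sequentially" "\<And>n. s n \<in> topspace X"
  shows "continuous_map N_space X (read_run l z (\<lambda>n _. s n))"
  using assms by (intro continuous_map_read_run) (auto simp: limitin_def)


section \<open>The loop in the odd hull of the graph on words\<close>

text \<open>When the runs in an edge grow with \<open>j\<close>, both ends of the edge converge to words that end in an
  infinite run, and the letters that told apart the two edges at such a word are lost in the
  limit.  For fixed \<open>k\<close> the limit edges therefore line up into a path.  It starts at \<open>C\<^sup>k\<^sup>+\<^sup>1A\<^sup>\<infinity>\<close>, moves
  through \<open>k 0\<^sup>\<infinity>, k 1\<^sup>\<infinity>, \<dots>, k (2k+1)\<^sup>\<infinity>\<close> and ends at \<open>C\<^sup>k\<^sup>+\<^sup>1Abar\<^sup>\<infinity>\<close>, with \<open>2k + 3\<close> steps.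
  Both ends tend to \<open>C\<^sup>\<infinity>\<close> with \<open>k\<close>.\<close>

lemma limit_path_G_m:
  "(replicate (k + 1) C \<frown> (\<lambda>_. A), replicate (k + 1) C \<frown> (\<lambda>_. Abar))
     \<in> (prod_topology N_space N_space closure_of G_m) ^^ (2 * (k + 1) + 1)"
proof -
  define R where "R = prod_topology N_space N_space closure_of G_m"
  have lim: "(u \<frown> (\<lambda>_. l), u' \<frown> (\<lambda>_. l')) \<in> R"
    if "\<And>j. ((u @ replicate (j + 1) l) \<frown> v, (u' @ replicate (j + 1) l') \<frown> v') \<in> O_m" for u u' v v' l l'
    unfolding R_def using that
    by (intro closure_of_prod_limit[OF _ limitin_N_space_long_run limitin_N_space_long_run])
       (auto simp: G_m_def symmetrization_def)
  have first: "(replicate (k + 1) C \<frown> (\<lambda>_. A), [Num k] \<frown> (\<lambda>_. Num 0)) \<in> R"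
    by (rule lim[where v = "\<lambda>_. Abar" and v' = "\<lambda>_. Abar"]) (unfold O_m_def append_Cons append_Nil, blast)
  have middle: "([Num k] \<frown> (\<lambda>_. Num i), [Num k] \<frown> (\<lambda>_. Num (i + 1))) \<in> R" if "i \<le> 2 * k" for i
    by (rule lim[where v = "\<lambda>_. A" and v' = "\<lambda>_. Abar"])
       (use that in \<open>unfold O_m_def append_Cons append_Nil, blast\<close>)
  have last: "([Num k] \<frown> (\<lambda>_. Num (2 * k + 1)), replicate (k + 1) C \<frown> (\<lambda>_. Abar)) \<in> R"
    by (rule lim[where v = "\<lambda>_. A" and v' = "\<lambda>_. A"]) (unfold O_m_def append_Cons append_Nil, blast)
  have "(replicate (k + 1) C \<frown> (\<lambda>_. A), [Num k] \<frown> (\<lambda>_. Num i)) \<in> R ^^ Suc i" if "i \<le> 2 * k + 1" for i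
    using that
  proof (induction i)
    case 0
    show ?case
      using first by simp
  next
    case (Suc i)
    then show ?case
      using middle[of i] by (intro relpow_Suc_I[of _ _ "Suc i"]) auto
  qed
  from relpow_Suc_I[OF this[OF order_refl] last]
  have "(replicate (k + 1) C \<frown> (\<lambda>_. A), replicate (k + 1) C \<frown> (\<lambda>_. Abar)) \<in> R ^^ Suc (Suc (2 * k + 1))" .
  moreover have "Suc (Suc (2 * k + 1)) = 2 * (k + 1) + 1"
    by simp
  ultimately show ?thesis
    unfolding R_def by metis
qed

lemma odd_hull_G_m_loop: "((\<lambda>_. C), (\<lambda>_. C)) \<in> odd_hull N_space G_m"
  unfolding odd_hull_def
proof (rule closure_of_prod_topologyI)
  fix V W
  assume "openin N_space V" "(\<lambda>_. C) \<in> V" "openin N_space W" "(\<lambda>_. C) \<in> W"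
  then have "\<exists>m. \<forall>v. (\<forall>i<m. v i = C) \<longrightarrow> v \<in> V" "\<exists>n. \<forall>v. (\<forall>i<n. v i = C) \<longrightarrow> v \<in> W"
    by (simp_all add: openin_N_space Ball_def)
  then obtain m n where m: "\<And>v. (\<forall>i<m. v i = C) \<Longrightarrow> v \<in> V" and n: "\<And>v. (\<forall>i<n. v i = C) \<Longrightarrow> v \<in> W"
    by blast
  let ?k = "max m n"
  have "replicate (?k + 1) C \<frown> (\<lambda>_. A) \<in> V"
    by (rule m) (auto simp: conc_def simp del: replicate_Suc)
  moreover have "replicate (?k + 1) C \<frown> (\<lambda>_. Abar) \<in> W"
    by (rule n) (auto simp: conc_def simp del: replicate_Suc)
  ultimately show "\<exists>a b. (a, b) \<in> (\<Union>p. (prod_topology N_space N_space closure_of G_m) ^^ (2 * p + 1))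
      \<and> a \<in> V \<and> b \<in> W"
    using limit_path_G_m[of ?k] by blast
qed simp_all


section \<open>Paths of prescribed length near a loop in the odd hull\<close>

text \<open>The requirement on \<open>B 0\<close> makes a condition to be met inside \<open>B n\<close> void for \<open>n = 0\<close>, so that \<open>0\<close>
  can serve as the default index in the diagonal choice of paths below.\<close>

definition decreasing_base :: "'a topology \<Rightarrow> 'a \<Rightarrow> (nat \<Rightarrow> 'a set) \<Rightarrow> bool" where
  "decreasing_base X x B \<longleftrightarrow>
     (\<forall>n. openin X (B n) \<and> x \<in> B n) \<and> antimono B \<and> B 0 = topspace X \<and>
     (\<forall>U. openin X U \<and> x \<in> U \<longrightarrow> (\<exists>n. B n \<subseteq> U))"

lemma first_countable_decreasing_base:
  assumes "first_countable X" "x \<in> topspace X"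
  obtains B where "decreasing_base X x B"
proof -
  obtain \<B> where \<B>: "countable \<B>" "\<And>V. V \<in> \<B> \<Longrightarrow> openin X V"
      "\<And>U. openin X U \<Longrightarrow> x \<in> U \<Longrightarrow> \<exists>V\<in>\<B>. x \<in> V \<and> V \<subseteq> U"
    using assms unfolding first_countable_def by meson
  define \<C> where "\<C> = {V \<in> \<B>. x \<in> V}"
  have "\<C> \<noteq> {}"
    using \<B>(3)[OF openin_topspace assms(2)] by (auto simp: \<C>_def)
  moreover have "countable \<C>"
    using \<B>(1) by (auto simp: \<C>_def intro: countable_subset)
  ultimately have e: "range (from_nat_into \<C>) = \<C>"
    by (rule range_from_nat_into)
  define B where "B n = topspace X \<inter> (\<Inter>i<n. from_nat_into \<C> i)" for n
  have C: "openin X (from_nat_into \<C> i)" "x \<in> from_nat_into \<C> i" for i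
    using e \<B>(2) unfolding \<C>_def by blast+
  have B_Suc: "B (Suc n) = B n \<inter> from_nat_into \<C> n" for n
    by (auto simp: B_def lessThan_Suc)
  have B0: "B 0 = topspace X"
    by (simp add: B_def)
  have "openin X (B n)" for n
    by (induction n) (use C in \<open>auto simp: B0 B_Suc\<close>)
  moreover have "x \<in> B n" for n
    using C assms(2) by (simp add: B_def)
  moreover have "antimono B"
    by (auto simp: B_def antimono_def)
  moreover have "\<exists>n. B n \<subseteq> U" if U: "openin X U" "x \<in> U" for U
  proof -
    obtain V where "V \<in> \<C>" "V \<subseteq> U"
      using \<B>(3)[OF U] by (auto simp: \<C>_def)
    then obtain i where "from_nat_into \<C> i \<subseteq> U"
      using e by (metis imageE)
    then have "B (Suc i) \<subseteq> U"
      unfolding B_Suc by blast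
    then show ?thesis
      by blast
  qed
  ultimately show thesis
    by (intro that[of B]) (simp add: decreasing_base_def B0)
qed

lemma closure_of_prod_sequences:
  assumes X: "first_countable X" and yz: "(y, z) \<in> prod_topology X X closure_of R"
    and V: "openin X V" "y \<in> V" and W: "openin X W" "z \<in> W"
  obtains f g :: "nat \<Rightarrow> 'a" where
    "\<And>n. (f n, g n) \<in> R" "\<And>n. f n \<in> V" "\<And>n. g n \<in> W"
    "limitin X f y sequentially" "limitin X g z sequentially"
proof -
  note top = closure_of_prod_topology_topspace[OF yz]
  obtain B where B: "decreasing_base X y B"
    using X top(1) by (rule first_countable_decreasing_base)
  obtain D where D: "decreasing_base X z D"
    using X top(2) by (rule first_countable_decreasing_base)
  have "\<exists>a b. (a, b) \<in> R \<and> a \<in> B n \<inter> V \<and> b \<in> D n \<inter> W" for n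
  proof -
    have "openin X (B n \<inter> V)" "y \<in> B n \<inter> V" "openin X (D n \<inter> W)" "z \<in> D n \<inter> W"
      using B D V W by (auto simp: decreasing_base_def)
    then show ?thesis
      by (rule closure_of_prod_topologyE[OF yz]) blast
  qed
  then obtain f g where fg: "\<And>n. (f n, g n) \<in> R" "\<And>n. f n \<in> B n \<inter> V" "\<And>n. g n \<in> D n \<inter> W"
    by metis
  have lim: "limitin X h w sequentially" if h: "\<And>n. h n \<in> E n" and E: "decreasing_base X w E" for h w E
    unfolding limitin_sequentially
  proof (intro conjI allI impI)
    show "w \<in> topspace X"
      using E by (metis decreasing_base_def)
    fix U assume "openin X U \<and> w \<in> U"
    then obtain N where "E N \<subseteq> U"
      using E unfolding decreasing_base_def by blast
    moreover have "E n \<subseteq> E N" if "N \<le> n" for n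
      using E that by (simp add: decreasing_base_def antimonoD)
    ultimately show "\<exists>N. \<forall>n\<ge>N. h n \<in> U"
      using h by blast
  qed
  show thesis
  proof (rule that[of f g])
    show "limitin X f y sequentially"
      by (rule lim[of f B]) (use fg B in auto)
    show "limitin X g z sequentially"
      by (rule lim[of g D]) (use fg D in auto)
  qed (use fg in auto)
qed

text \<open>Walking back and forth along the first edge lengthens a path by two.\<close>

lemma relpow_sym_lengthen:
  assumes "sym R" "(y, z) \<in> R ^^ Suc n"
  shows "(y, z) \<in> R ^^ (Suc n + 2 * k)"
proof (induction k)
  case (Suc k)
  then obtain y' where y': "(y, y') \<in> R" "(y', z) \<in> R ^^ (n + 2 * k)"
    by (metis add_Suc relpow_Suc_D2)
  then have "(y, z) \<in> R ^^ Suc (Suc (Suc (n + 2 * k)))"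
    using assms(1) by (meson relpow_Suc_I2 symD)
  then show ?case
    by simp
qed (use assms in simp)

text \<open>Take for \<open>m k\<close> the largest \<open>n \<le> k\<close> that \<open>P\<close> allows at stage \<open>k\<close>.\<close>

lemma diagonal_index:
  fixes P :: "nat \<Rightarrow> nat \<Rightarrow> bool"
  assumes "\<And>k. P 0 k" "\<And>n. \<forall>\<^sub>F k in sequentially. P n k"
  shows "\<exists>m. (\<forall>k. P (m k) k) \<and> (\<forall>n. \<forall>\<^sub>F k in sequentially. n \<le> m k)"
proof (intro exI conjI allI)
  define m where "m k = Max {n. n \<le> k \<and> P n k}" for k
  have fin: "finite {n. n \<le> k \<and> P n k}" for k
    by simp
  have "{n. n \<le> k \<and> P n k} \<noteq> {}" for k
    using assms(1) by blast
  from Max_in[OF fin this] show "P (m k) k" for k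
    by (simp add: m_def)
  show "\<forall>\<^sub>F k in sequentially. n \<le> m k" for n
    using assms(2)[of n] eventually_ge_at_top[of n]
    by eventually_elim (auto simp: m_def intro: Max_ge)
qed

text \<open>A point of the odd hull only promises, near \<open>(x, x)\<close>, paths of uncontrolled odd length.  Since
  paths can be lengthened by two, every neighborhood of \<open>(x, x)\<close> contains the ends of a path of
  length \<open>2k + 3\<close> for all large \<open>k\<close>, and diagonalizing over a neighborhood base at \<open>x\<close> leaves
  one path for each \<open>k\<close>.  For the first few \<open>k\<close> the ends may lie anywhere, which is why the base
  starts with the whole space.\<close>

lemma odd_hull_loop_imp_paths:
  assumes X: "first_countable X" and "sym G" and loop: "(x, x) \<in> odd_hull X G"
  shows "\<exists>W p.
    (\<forall>k. openin X (W k)) \<and> (\<forall>U. openin X U \<and> x \<in> U \<longrightarrow> (\<forall>\<^sub>F k in sequentially. W k \<subseteq> U)) \<and>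
    (\<forall>k::nat. p k 0 \<in> W k \<and> p k (2 * k + 3) \<in> W k \<and>
      (\<forall>i<2 * k + 3. (p k i, p k (Suc i)) \<in> prod_topology X X closure_of G))"
proof -
  define R where "R = prod_topology X X closure_of G"
  have "sym R"
    unfolding R_def using \<open>sym G\<close> by (rule sym_closure_of_prod_topology)
  have x: "x \<in> topspace X"
    using loop unfolding odd_hull_def by (rule closure_of_prod_topology_topspace)
  obtain B where base: "decreasing_base X x B"
    using X x by (rule first_countable_decreasing_base)
  then have B: "\<And>n. openin X (B n)" "\<And>n. x \<in> B n" "antimono B" "B 0 = topspace X"
    by (simp_all add: decreasing_base_def)
  define P where "P n k \<longleftrightarrow> (\<exists>y\<in>B n. \<exists>z\<in>B n. (y, z) \<in> R ^^ (2 * k + 3))" for n k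
  have short: "\<exists>p. \<exists>y\<in>B n. \<exists>z\<in>B n. (y, z) \<in> R ^^ (2 * p + 1)" for n
    using closure_of_prod_topologyE[OF loop[unfolded odd_hull_def] B(1,2) B(1,2), of n n]
    unfolding R_def by blast
  have long: "P n k" if "y \<in> B n" "z \<in> B n" "(y, z) \<in> R ^^ (2 * p + 1)" "p \<le> k" for n k p y z
  proof -
    have "(y, z) \<in> R ^^ (Suc (2 * p) + 2 * (k + 1 - p))"
      using that(3) by (intro relpow_sym_lengthen[OF \<open>sym R\<close>]) simp
    moreover have "Suc (2 * p) + 2 * (k + 1 - p) = 2 * k + 3"
      using \<open>p \<le> k\<close> by simp
    ultimately show ?thesis
      unfolding P_def using that by metis
  qed
  \<comment> \<open>A single edge of the closure, walked back and forth, is a path of any odd length.\<close>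
  have "P 0 k" for k
  proof -
    obtain p y z where "(y, z) \<in> R ^^ (2 * p + 1)"
      using short by blast
    then obtain y' where "(y, y') \<in> R"
      by (metis Suc_eq_plus1 relpow_Suc_D2)
    then have "y \<in> B 0" "y' \<in> B 0" "(y, y') \<in> R ^^ (2 * 0 + 1)"
      unfolding B(4) R_def by (auto dest: closure_of_prod_topology_topspace)
    then show ?thesis
      by (rule long) simp
  qed
  moreover have "\<forall>\<^sub>F k in sequentially. P n k" for n
    using short[of n] long unfolding eventually_sequentially by blast
  ultimately have "\<exists>m. (\<forall>k. P (m k) k) \<and> (\<forall>n. \<forall>\<^sub>F k in sequentially. n \<le> m k)"
    by (rule diagonal_index)
  then obtain m where m: "\<And>k. P (m k) k" "\<And>n. \<forall>\<^sub>F k in sequentially. n \<le> m k"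
    by blast
  define Q where "Q k q \<longleftrightarrow>
      q 0 \<in> B (m k) \<and> q (2 * k + 3) \<in> B (m k) \<and> (\<forall>i<2 * k + 3. (q i, q (Suc i)) \<in> R)" for k q
  have "\<exists>q. Q k q" for k
  proof -
    obtain y z where "y \<in> B (m k)" "z \<in> B (m k)" "(y, z) \<in> R ^^ (2 * k + 3)"
      using m(1)[of k] unfolding P_def by blast
    then show ?thesis
      unfolding relpow_fun_conv Q_def by blast
  qed
  then obtain p where Q: "\<And>k. Q k (p k)"
    by metis
  have p: "p k 0 \<in> B (m k)" "p k (2 * k + 3) \<in> B (m k)"
      "i < 2 * k + 3 \<Longrightarrow> (p k i, p k (Suc i)) \<in> R" for k i
    using Q[of k] unfolding Q_def by simp_all
  have small: "\<forall>\<^sub>F k in sequentially. B (m k) \<subseteq> U" if U: "openin X U \<and> x \<in> U" for U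
  proof -
    have "\<exists>n. B n \<subseteq> U"
      using base U by (simp add: decreasing_base_def)
    then obtain n where n: "B n \<subseteq> U" ..
    have "B (m k) \<subseteq> U" if k: "n \<le> m k" for k
      using antimonoD[OF B(3) k] n by (rule order_trans)
    then show ?thesis
      using eventually_mono[OF m(2)[of n]] by simp
  qed
  show ?thesis
    using B(1) p small unfolding R_def
    by (intro exI[of _ "\<lambda>k. B (m k)"] exI[of _ p] conjI allI impI) blast+
qed


section \<open>The continuous homomorphism attached to a sequence of paths\<close>

text \<open>The data from which the homomorphism is built: for each \<open>k\<close> a path \<open>p k\<close> of length \<open>2k + 3\<close>
  whose \<open>i\<close>-th step is the limit of the edges \<open>(f k i n, g k i n)\<close> of \<open>G\<close>.  The set \<open>W k\<close> holds the
  two ends of the path and the sequences that approximate these ends; it is what gives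
  continuity at the word \<open>C\<^sup>\<infinity>\<close>, which is sent to \<open>x\<close>.\<close>

locale approximated_paths =
  fixes X :: "'a topology" and G :: "('a \<times> 'a) set" and x :: 'a
    and W :: "nat \<Rightarrow> 'a set" and p :: "nat \<Rightarrow> nat \<Rightarrow> 'a" and f g :: "nat \<Rightarrow> nat \<Rightarrow> nat \<Rightarrow> 'a"
  assumes x_in: "x \<in> topspace X"
    and W_subset: "W k \<subseteq> topspace X"
    and W_small: "\<And>U. openin X U \<Longrightarrow> x \<in> U \<Longrightarrow> \<forall>\<^sub>F k in sequentially. W k \<subseteq> U"
    and ends_in_W: "p k 0 \<in> W k" "p k (2 * k + 3) \<in> W k" "f k 0 n \<in> W k" "g k (2 * k + 2) n \<in> W k"
    and in_X: "i < 2 * k + 3 \<Longrightarrow> f k i n \<in> topspace X" "i < 2 * k + 3 \<Longrightarrow> g k i n \<in> topspace X"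
    and lim: "i < 2 * k + 3 \<Longrightarrow> limitin X (f k i) (p k i) sequentially"
      "i < 2 * k + 3 \<Longrightarrow> limitin X (g k i) (p k (Suc i)) sequentially"
    and edge: "i < 2 * k + 3 \<Longrightarrow> (f k i n, g k i n) \<in> G"
begin

text \<open>The word \<open>C\<^sup>k\<^sup>+\<^sup>1A\<^sup>\<infinity>\<close> is sent to the first vertex of the \<open>k\<close>-th path, \<open>k i\<^sup>\<infinity>\<close> to the vertex number
  \<open>i + 1\<close> and \<open>C\<^sup>k\<^sup>+\<^sup>1Abar\<^sup>\<infinity>\<close> to the last one.  A word with a finite run of length \<open>n\<close> is an end of the
  \<open>n\<close>-th edge approximating a step of the path.  A vertex inside the path ends one step and
  starts the next one, and the letter after the run tells which of the two steps is meant.  In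
  the first three maps \<open>l\<close> stands for the first letter of the word that is read.  On words that
  follow none of these patterns the values \<open>x\<close> and \<open>p k 0\<close> are arbitrary, except that the value at
  a word with an initial run of \<open>k + 1\<close> letters \<open>C\<close> must lie in \<open>W k\<close>, as \<open>p k 0\<close> does.\<close>

definition end_map :: "nat \<Rightarrow> letter \<Rightarrow> letter word \<Rightarrow> 'a" where
  "end_map k l = (case l of
       A \<Rightarrow> read_run A (p k 0) (\<lambda>n _. f k 0 n)
     | Abar \<Rightarrow> read_run Abar (p k (2 * k + 3)) (\<lambda>n _. g k (2 * k + 2) n)
     | _ \<Rightarrow> (\<lambda>_. p k 0))"

definition inner_map :: "nat \<Rightarrow> letter \<Rightarrow> letter word \<Rightarrow> 'a" where
  "inner_map k l = (case l of
       Num i \<Rightarrow> if i \<le> 2 * k + 1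
         then read_run (Num i) (p k (i + 1)) (\<lambda>n w. if w 0 = A then f k (i + 1) n else g k i n)
         else (\<lambda>_. x)
     | _ \<Rightarrow> (\<lambda>_. x))"

definition start_map :: "letter \<Rightarrow> letter word \<Rightarrow> 'a" where
  "start_map l w = (case l of Num k \<Rightarrow> inner_map k (suffix 1 w 0) (suffix 1 w) | _ \<Rightarrow> x)"

definition path_map :: "letter word \<Rightarrow> 'a" where
  "path_map = read_run C x
     (\<lambda>n w. case n of 0 \<Rightarrow> start_map (w 0) w | Suc k \<Rightarrow> end_map k (w 0) w)"

lemma end_map_in_W: "end_map k l w \<in> W k"
  using ends_in_W by (auto simp: end_map_def read_run_def Let_def split: letter.split)

lemma continuous_map_end_map: "continuous_map N_space X (\<lambda>w. end_map k (w 0) w)"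
proof (rule continuous_map_N_space_first_letter[of X "end_map k"])
  have "p k 0 \<in> topspace X"
    using ends_in_W W_subset by blast
  moreover have "limitin X (g k (2 * k + 2)) (p k (2 * k + 3)) sequentially"
    using lim(2)[of "2 * k + 2" k] by (simp add: numeral_3_eq_3)
  ultimately show "continuous_map N_space X (end_map k l)" for l
    using lim(1)[of 0 k] in_X[of _ k]
    by (auto simp: end_map_def split: letter.split intro!: continuous_map_read_run_sequence)
qed

lemma continuous_map_inner_map: "continuous_map N_space X (\<lambda>w. inner_map k (w 0) w)"
proof (rule continuous_map_N_space_first_letter[of X "inner_map k"])
  fix l
  let ?h = "\<lambda>i n l. if l = A then f k (i + 1) n else g k i n"
  have "continuous_map N_space X (read_run (Num i) (p k (i + 1)) (\<lambda>n w. ?h i n (w 0)))"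
    if i: "i \<le> 2 * k + 1" for i
  proof (rule continuous_map_read_run)
    show "continuous_map N_space X (\<lambda>w. ?h i n (w 0))" for n
      by (rule continuous_map_N_space_first_letter[of X "\<lambda>l _. ?h i n l"])
         (use i in_X in auto)
    have lims: "limitin X (f k (i + 1)) (p k (i + 1)) sequentially"
        "limitin X (g k i) (p k (i + 1)) sequentially"
      using i lim[of "i + 1" k] lim[of i k] by simp_all
    then show "p k (i + 1) \<in> topspace X"
      by (simp add: limitin_def)
    fix U assume "openin X U" "p k (i + 1) \<in> U"
    then have "\<forall>\<^sub>F n in sequentially. f k (i + 1) n \<in> U" "\<forall>\<^sub>F n in sequentially. g k i n \<in> U"
      using lims unfolding limitin_def by blast+
    then show "\<forall>\<^sub>F n in sequentially. \<forall>w. ?h i n (w 0) \<in> U"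
      by eventually_elim simp
  qed
  then show "continuous_map N_space X (inner_map k l)"
    using x_in by (auto simp: inner_map_def split: letter.split)
qed

text \<open>After an initial run of \<open>k + 1\<close> letters \<open>C\<close> all values lie in \<open>W k\<close>, whatever follows, and the
  sets \<open>W k\<close> shrink to \<open>x\<close>; so the runs of \<open>C\<close> are read continuously.\<close>

lemma continuous_map_path_map: "continuous_map N_space X path_map"
  unfolding path_map_def
proof (rule continuous_map_read_run)
  have "continuous_map N_space X (\<lambda>w. inner_map k (suffix 1 w 0) (suffix 1 w))" for k
    using continuous_map_N_space_suffix[of X "\<lambda>w. inner_map k (w 0) w" 1] continuous_map_inner_map by blast
  then have "continuous_map N_space X (start_map l)" for l
    unfolding start_map_def using x_in by (cases l) (simp_all del: suffix_nth)
  then have "continuous_map N_space X (\<lambda>w. start_map (w 0) w)"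
    by (rule continuous_map_N_space_first_letter)
  then show "continuous_map N_space X (\<lambda>w. case n of 0 \<Rightarrow> start_map (w 0) w | Suc k \<Rightarrow> end_map k (w 0) w)" for n
    using continuous_map_end_map by (cases n) auto
  fix U assume "openin X U" "x \<in> U"
  then have "\<forall>\<^sub>F k in sequentially. W k \<subseteq> U"
    by (rule W_small)
  then have "\<forall>\<^sub>F k in sequentially. \<forall>w. end_map k (w 0) w \<in> U"
    by eventually_elim (use end_map_in_W in blast)
  \<comment> \<open>A run of length \<open>n = Suc k\<close> belongs to the \<open>k\<close>-th path.\<close>
  then show "\<forall>\<^sub>F n in sequentially. \<forall>w. (case n of 0 \<Rightarrow> start_map (w 0) w | Suc k \<Rightarrow> end_map k (w 0) w) \<in> U"
    by (subst eventually_sequentially_Suc[symmetric]) simp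
qed (rule x_in)

lemma replicate_Suc_conc_0: "(replicate (j + 1) l \<frown> v) 0 = l"
  by (simp add: conc_def)

lemma path_map_end:
  assumes "l \<noteq> C"
  shows "path_map ((replicate (k + 1) C @ replicate (j + 1) l) \<frown> v) = end_map k l (replicate (j + 1) l \<frown> v)"
proof -
  have "path_map (replicate (k + 1) C \<frown> (replicate (j + 1) l \<frown> v)) = end_map k l (replicate (j + 1) l \<frown> v)"
    unfolding path_map_def using assms
    by (subst read_run_replicate) (simp_all add: replicate_Suc_conc_0 del: replicate_Suc)
  then show ?thesis
    by (simp only: conc_conc)
qed

lemma path_map_inner:
  assumes "i \<le> 2 * k + 1" "v 0 \<noteq> Num i"
  shows "path_map ((Num k # replicate (j + 1) (Num i)) \<frown> v)
    = (if v 0 = A then f k (i + 1) (j + 1) else g k i (j + 1))"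
proof -
  let ?w = "(Num k # replicate (j + 1) (Num i)) \<frown> v"
  have suffix: "suffix 1 ?w = replicate (j + 1) (Num i) \<frown> v"
    by (auto simp: fun_eq_iff conc_def)
  have "path_map ?w = start_map (?w 0) (suffix 0 ?w)"
    unfolding path_map_def by (subst read_run_eq[of 0]) (simp_all add: conc_def)
  also have "\<dots> = inner_map k (suffix 1 ?w 0) (suffix 1 ?w)"
    by (simp add: start_map_def conc_def)
  also have "\<dots> = inner_map k (Num i) (replicate (j + 1) (Num i) \<frown> v)"
    unfolding suffix replicate_Suc_conc_0 ..
  also have "\<dots> = (if v 0 = A then f k (i + 1) (j + 1) else g k i (j + 1))"
    using assms by (simp only: inner_map_def letter.case if_True read_run_replicate[of v "Num i", OF assms(2)])
  finally show ?thesis .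
qed

text \<open>The three families of edges of the graph on words are the first step of the path, the steps
  between inner vertices and the last step, so for a run of length \<open>j + 1\<close> the two ends of an
  edge are sent to the two ends of edge number \<open>j + 1\<close> in the sequence approximating that step.\<close>

lemma path_map_O_m:
  assumes "(v, w) \<in> O_m"
  shows "(path_map v, path_map w) \<in> G"
proof -
  have end_A: "end_map k A (replicate (j + 1) A \<frown> (\<lambda>_. Abar)) = f k 0 (j + 1)" for j k
    unfolding end_map_def letter.case by (rule read_run_replicate) simp
  have end_Abar: "end_map k Abar (replicate (j + 1) Abar \<frown> (\<lambda>_. A)) = g k (2 * k + 2) (j + 1)" for j k
    unfolding end_map_def letter.case by (rule read_run_replicate) simp
  from assms consider
    j k where "v = (replicate (k + 1) C @ replicate (j + 1) A) \<frown> (\<lambda>_. Abar)"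
      "w = (Num k # replicate (j + 1) (Num 0)) \<frown> (\<lambda>_. Abar)"
  | j k i where "i \<le> 2 * k" "v = (Num k # replicate (j + 1) (Num i)) \<frown> (\<lambda>_. A)"
      "w = (Num k # replicate (j + 1) (Num (i + 1))) \<frown> (\<lambda>_. Abar)"
  | j k where "v = (Num k # replicate (j + 1) (Num (2 * k + 1))) \<frown> (\<lambda>_. A)"
      "w = (replicate (k + 1) C @ replicate (j + 1) Abar) \<frown> (\<lambda>_. A)"
    unfolding O_m_def by blast
  then show ?thesis
  proof cases
    case 1
    have "path_map v = f k 0 (j + 1)"
      unfolding 1 by (subst path_map_end) (simp, rule end_A)
    moreover have "path_map w = g k 0 (j + 1)"
      unfolding 1 by (subst path_map_inner) simp_all
    ultimately show ?thesis
      using edge[of 0 k "j + 1"] by simp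
  next
    case 2
    have "path_map v = f k (i + 1) (j + 1)"
      unfolding 2 by (subst path_map_inner) (use 2(1) in simp_all)
    moreover have "path_map w = g k (i + 1) (j + 1)"
      unfolding 2 by (subst path_map_inner) (use 2(1) in simp_all)
    ultimately show ?thesis
      using edge[of "i + 1" k "j + 1"] 2(1) by simp
  next
    case 3
    have "path_map v = f k (2 * k + 2) (j + 1)"
      unfolding 3 by (subst path_map_inner) simp_all
    moreover have "path_map w = g k (2 * k + 2) (j + 1)"
      unfolding 3 by (subst path_map_end) (simp, rule end_Abar)
    ultimately show ?thesis
      using edge[of "2 * k + 2" k "j + 1"] by simp
  qed
qed

end

text \<open>First countability enters a second time: the steps of the paths only lie in the closure of \<open>G\<close>,
  and it turns each of them into the limit of a sequence of edges, one edge for each length of a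
  run.\<close>

lemma odd_hull_loop_imp_cont_reducible:
  assumes X: "first_countable X" and "sym G" and loop: "(x, x) \<in> odd_hull X G"
  shows "cont_reducible N_space G_m X G"
proof -
  obtain W p where
    W: "\<forall>k. openin X (W k)" "\<forall>U. openin X U \<and> x \<in> U \<longrightarrow> (\<forall>\<^sub>F k in sequentially. W k \<subseteq> U)"
    and p: "\<forall>k::nat. p k 0 \<in> W k \<and> p k (2 * k + 3) \<in> W k \<and>
      (\<forall>i<2 * k + 3. (p k i, p k (Suc i)) \<in> prod_topology X X closure_of G)"
    using odd_hull_loop_imp_paths[OF assms] by (elim exE conjE)
  have ends: "p k 0 \<in> W k" "p k (2 * k + 3) \<in> W k"
    and step: "i < 2 * k + 3 \<Longrightarrow> (p k i, p k (Suc i)) \<in> prod_topology X X closure_of G" for k i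
    using p by simp_all
  \<comment> \<open>Only the ends of the path have to be approximated inside \<open>W k\<close>.\<close>
  define V where "V k i = (if i = 0 \<or> i = 2 * k + 3 then W k else topspace X)" for k i
  define Q where "Q k i f g \<longleftrightarrow> (\<forall>n. (f n, g n) \<in> G \<and> f n \<in> V k i \<and> g n \<in> V k (Suc i)) \<and>
      limitin X f (p k i) sequentially \<and> limitin X g (p k (Suc i)) sequentially" for k i f g
  have ex_Q: "\<exists>h. Q k i (fst h) (snd h)" if i: "i < 2 * k + 3" for k i
  proof -
    have "p k (Suc i) \<in> W k" if "Suc i = 2 * k + 3"
      unfolding that by (rule ends(2))
    then have "openin X (V k i)" "p k i \<in> V k i" "openin X (V k (Suc i))" "p k (Suc i) \<in> V k (Suc i)"
      using W(1) ends(1) i closure_of_prod_topology_topspace[OF step[OF i]] by (auto simp: V_def)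
    then obtain f g where "Q k i f g"
      unfolding Q_def by (rule closure_of_prod_sequences[OF X step[OF i]]) blast
    then show ?thesis
      by (intro exI[of _ "(f, g)"]) simp
  qed
  define f g where "f k i = fst (SOME h. Q k i (fst h) (snd h))"
    and "g k i = snd (SOME h. Q k i (fst h) (snd h))" for k i
  have Q: "Q k i (f k i) (g k i)" if "i < 2 * k + 3" for k i
    unfolding f_def g_def using ex_Q[OF that] by (rule someI_ex)
  have fg: "(f k i n, g k i n) \<in> G" "f k i n \<in> V k i" "g k i n \<in> V k (Suc i)"
      "limitin X (f k i) (p k i) sequentially" "limitin X (g k i) (p k (Suc i)) sequentially"
    if "i < 2 * k + 3" for k i n
    using Q[OF that] unfolding Q_def by simp_all
  have W_subset: "W k \<subseteq> topspace X" for k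
    using W(1) by (blast dest: openin_subset)
  then have V_subset: "V k i \<subseteq> topspace X" for k i
    by (simp add: V_def)
  interpret approximated_paths X G x W p f g
  proof
    show "x \<in> topspace X"
      using loop unfolding odd_hull_def by (rule closure_of_prod_topology_topspace)
    show "f k 0 n \<in> W k" for k n
      using fg(2)[of 0 k n] by (simp add: V_def)
    show "g k (2 * k + 2) n \<in> W k" for k n
      using fg(3)[of "2 * k + 2" k n] by (simp add: V_def)
    show "f k i n \<in> topspace X" if "i < 2 * k + 3" for i k n
      using fg(2)[OF that] V_subset by blast
    show "g k i n \<in> topspace X" if "i < 2 * k + 3" for i k n
      using fg(3)[OF that] V_subset by blast
    show "\<forall>\<^sub>F k in sequentially. W k \<subseteq> U" if "openin X U" "x \<in> U" for U
      using W(2) that by blast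
    show "limitin X (f k i) (p k i) sequentially" if "i < 2 * k + 3" for i k
      using fg(4)[OF that] .
    show "limitin X (g k i) (p k (Suc i)) sequentially" if "i < 2 * k + 3" for i k
      using fg(5)[OF that] .
    show "(f k i n, g k i n) \<in> G" if "i < 2 * k + 3" for i k n
      using fg(1)[OF that] .
  qed (rule ends W_subset)+
  have "G_m \<subseteq> map_prod path_map path_map -` G"
    using path_map_O_m symD[OF \<open>sym G\<close>] by (auto simp: G_m_def symmetrization_def)
  then show ?thesis
    unfolding cont_reducible_def using continuous_map_path_map by blast
qed


section \<open>The characterization\<close>

theorem theorem1p7:
  fixes X :: "'a topology" and G :: "('a \<times> 'a) set"
  assumes "first_countable X"
    and "graph_on (topspace X) G"
  shows "(Id_on (topspace X) \<inter>
            (prod_topology X X closure_of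
              (\<Union>p::nat. (prod_topology X X closure_of G) ^^ (2 * p + 1))) \<noteq> {}
          \<longleftrightarrow> cont_reducible N_space G_m X G) \<and>
         (cont_reducible N_space G_m X G \<longrightarrow> \<not> (\<exists>c. continuous_2_coloring X G c))"
proof -
  have "sym G" and G: "G \<subseteq> topspace X \<times> topspace X"
    using assms(2) by (auto simp: graph_on_def digraph_on_def)
  have hull: "Id_on (topspace X) \<inter> odd_hull X G \<noteq> {} \<longleftrightarrow> (\<exists>x. (x, x) \<in> odd_hull X G)"
    unfolding odd_hull_def by (auto dest: closure_of_prod_topology_topspace)
  have loop: "\<exists>x. (x, x) \<in> odd_hull X G" if "cont_reducible N_space G_m X G"
    using that odd_hull_continuous_image[OF _ _ odd_hull_G_m_loop]
    unfolding cont_reducible_def by blast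
  show ?thesis
    unfolding odd_hull_def[symmetric] hull
    using loop odd_hull_loop_imp_cont_reducible[OF assms(1) \<open>sym G\<close>]
      odd_hull_loop_imp_no_coloring[OF G] by blast
qed

end
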